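(* Let $\mu>0$ and $\eta=\mu^2/4$. For $y>x>0$ and $t>0$ let $$v(x,y,t)=\frac{1}{\sqrt{4\pi t}}\,e^{-\frac{(y-x-\mu t)^2}{4t}}+\frac{1}{\sqrt{4\pi t}}\,e^{-\frac{(y-x+\mu t)^2}{4t}}$$ be the transition density (the density at $y$) of the process $|B(t)+\mu t|+x$. Then $v$ satisfies the fractional equation $$\mathscr{D}_t^{\frac12,\eta}v=-\frac{\partial v}{\partial y}+v\,\sqrt{\eta}\,\tanh\big(\sqrt{\eta}\,(y-x)\big)-\frac{\mu}{2}\,v,\qquad y>x>0,\ t>0,$$ with initial and boundary conditions $$v(x,y,0)=\delta(y-x),\qquad v(x,x,t)=\frac{e^{-\eta t}}{\sqrt{\pi t}},\quad t>0.$$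
   Context: $B$ is a Brownian motion on $\mathbb{R}$ starting at the origin with generator $\Delta=\frac{d^2}{dx^2}$ (so $B(t)$ is a centered Gaussian variable with variance $2t$). $\mathscr{D}_t^{\frac12}$ is the Riemann--Liouville derivative of order $\frac12$ in $t$, $\big(\mathscr{D}_t^{\frac12}f\big)(t)=\frac{1}{\sqrt{\pi}}\frac{d}{dt}\int_0^t f(s)(t-s)^{-\frac12}\,ds$, and for $\eta>0$ the tempered Riemann--Liouville type derivative is $$\mathscr{D}_t^{\frac12,\eta}f:=e^{-\eta t}\,\mathscr{D}_t^{\frac12}\big(e^{\eta t}f\big)-\sqrt{\eta}\,f .$$ The derivative acts on the variable $t$ with $x,y$ fixed. The initial condition is understood in the sense that, for each $x$, the measures $v(x,y,t)\,dy$ on $(x,\infty)$ converge weakly to the Dirac mass at $x$ as $t\downarrow0$; the value $v(x,x,t)$ is the limit of $v(x,y,t)$ as $y\downarrow x$. *)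

theory Defs
  imports "HOL-Probability.Probability"
begin

text \<open>
  Brownian motion on the real line started at the origin with generator \<open>d\<^sup>2/dx\<^sup>2\<close>
  (not one half of it), so that an increment over a time interval of length \<open>h\<close> has
  variance \<open>2 h\<close>. The time parameter is a real number; only times \<open>t \<ge> 0\<close> matter.
\<close>

locale brownian_motion = prob_space M for M :: "'a measure" +
  fixes B :: "real \<Rightarrow> 'a \<Rightarrow> real"
  assumes measurable_B: "\<And>t. 0 \<le> t \<Longrightarrow> random_variable borel (B t)"
    and start_origin: "AE \<omega> in M. B 0 \<omega> = 0"
    and indep_increments:
      "\<And>(n::nat) (\<tau>::nat \<Rightarrow> real). \<lbrakk>0 \<le> \<tau> 0; mono_on {..n} \<tau>\<rbrakk> \<Longrightarrow>
         indep_vars (\<lambda>_. borel) (\<lambda>i \<omega>. B (\<tau> (Suc i)) \<omega> - B (\<tau> i) \<omega>) {..<n}"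
    and gaussian_increments:
      "\<And>s t. \<lbrakk>0 \<le> s; s < t\<rbrakk> \<Longrightarrow>
         distributed M lborel (\<lambda>\<omega>. B t \<omega> - B s \<omega>) (normal_density 0 (sqrt (2 * (t - s))))"
    and continuous_paths: "AE \<omega> in M. continuous_on {0..} (\<lambda>t. B t \<omega>)"

definition drift_density :: "real \<Rightarrow> real \<Rightarrow> real \<Rightarrow> real \<Rightarrow> real" where
  "drift_density \<mu> x y t =
     1 / sqrt (4 * pi * t) * exp (- ((y - x - \<mu> * t)\<^sup>2 / (4 * t))) +
     1 / sqrt (4 * pi * t) * exp (- ((y - x + \<mu> * t)\<^sup>2 / (4 * t)))"

definition RL_half_deriv :: "(real \<Rightarrow> real) \<Rightarrow> real \<Rightarrow> real" where
  "RL_half_deriv f t =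
     1 / sqrt pi * deriv (\<lambda>u. LBINT s:{0<..<u}. f s * (u - s) powr (- 1 / 2)) t"

text \<open>
  Both the Bochner integral and \<^const>\<open>deriv\<close> are total functions; the following predicate
  says that the integrals exist near \<open>t\<close> and that the derivative at \<open>t\<close> exists.
\<close>

definition RL_half_differentiable :: "(real \<Rightarrow> real) \<Rightarrow> real \<Rightarrow> bool" where
  "RL_half_differentiable f t \<longleftrightarrow>
     (\<forall>\<^sub>F u in nhds t. set_integrable lborel {0<..<u} (\<lambda>s. f s * (u - s) powr (- 1 / 2))) \<and>
     (\<lambda>u. LBINT s:{0<..<u}. f s * (u - s) powr (- 1 / 2)) field_differentiable at t"

definition tempered_half_deriv :: "real \<Rightarrow> (real \<Rightarrow> real) \<Rightarrow> real \<Rightarrow> real" where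
  "tempered_half_deriv \<eta> f t =
     exp (- (\<eta> * t)) * RL_half_deriv (\<lambda>s. exp (\<eta> * s) * f s) t - sqrt \<eta> * f t"

definition tempered_half_differentiable :: "real \<Rightarrow> (real \<Rightarrow> real) \<Rightarrow> real \<Rightarrow> bool" where
  "tempered_half_differentiable \<eta> f t \<longleftrightarrow> RL_half_differentiable (\<lambda>s. exp (\<eta> * s) * f s) t"

text \<open>
  Weak convergence along an arbitrary filter, tested against bounded continuous functions;
  \<^const>\<open>weak_conv_m\<close> covers sequences only. Finiteness of the measures
  makes all test integrals exist.
\<close>

definition weakly_tends_to :: "('b \<Rightarrow> real measure) \<Rightarrow> real measure \<Rightarrow> 'b filter \<Rightarrow> bool" where
  "weakly_tends_to N L F \<longleftrightarrow>
     (\<forall>\<^sub>F t in F. finite_borel_measure (N t)) \<and> finite_borel_measure L \<and>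
     (\<forall>f :: real \<Rightarrow> real. continuous_on UNIV f \<and> bounded (range f) \<longrightarrow>
        ((\<lambda>t. \<integral>y. f y \<partial>N t) \<longlongrightarrow> (\<integral>y. f y \<partial>L)) F)"

end

theory Submission
  imports Defs "HOL-Real_Asymp.Real_Asymp"
begin

text \<open>
  With \<open>a = y - x\<close>, completing the square shows that \<open>exp (\<eta> s) v(x, y, s)\<close> is
  \<open>cosh (\<surd>\<eta> a) / \<surd>\<pi>\<close> times the driftless kernel \<open>s powr (-1/2) * exp (- a\<^sup>2 / (4 s))\<close>.
  The substitution \<open>s = u / (1 + w\<^sup>2)\<close> (\<open>w < 0\<close>),
  followed by Tonelli after writing \<open>exp (- c K) / K\<close> as the integral of \<open>exp (- b K)\<close> over \<open>b \<ge> c\<close>, turns the half integral of this kernel into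
  \<open>\<integral> exp (- b) \<surd>(\<pi> / b) db\<close> over \<open>b > a\<^sup>2 / (4 u)\<close>, whose \<open>u\<close>-derivative is explicit.
  The \<open>sinh\<close> term of \<open>\<partial>v/\<partial>y\<close> cancels against the \<open>tanh\<close> term.
  For the initial condition, \<open>v(x, y, t) dy\<close> is the law of \<open>\<bar>\<surd>(2 t) Z + \<mu> t\<bar> + x\<close>
  with a single standard normal \<open>Z\<close> for all \<open>t\<close>, so dominated convergence applies.
\<close>

section \<open>Gaussian and exponential integrals over half-lines\<close>

lemma nn_integral_fold:
  fixes f :: "real \<Rightarrow> ennreal"
  assumes [measurable]: "f \<in> borel_measurable borel"
  shows "(\<integral>\<^sup>+z. f z \<partial>lborel) = (\<integral>\<^sup>+z. (f z + f (- z)) * indicator {0<..} z \<partial>lborel)"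
proof -
  \<comment> \<open>The origin is a null set, so the two open half-lines carry the whole
    integral.\<close>
  have "AE z in lborel. z \<noteq> (0::real)" by (rule AE_lborel_singleton)
  then have "(\<integral>\<^sup>+z. f z \<partial>lborel) =
      (\<integral>\<^sup>+z. f z * indicator {0<..} z + f z * indicator {..<0} z \<partial>lborel)"
    by (intro nn_integral_cong_AE) (auto elim!: eventually_mono simp: indicator_def)
  also have "\<dots> = (\<integral>\<^sup>+z. f z * indicator {0<..} z \<partial>lborel) + (\<integral>\<^sup>+z. f z * indicator {..<0} z \<partial>lborel)"
    by (rule nn_integral_add) auto
  also have "(\<integral>\<^sup>+z. f z * indicator {..<0} z \<partial>lborel) = (\<integral>\<^sup>+z. f (- z) * indicator {0<..} z \<partial>lborel)"
    by (subst nn_integral_real_affine[where c = "-1" and t = 0])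
      (auto simp: indicator_def intro!: nn_integral_cong)
  also have "(\<integral>\<^sup>+z. f z * indicator {0<..} z \<partial>lborel) + \<dots> =
      (\<integral>\<^sup>+z. (f z + f (- z)) * indicator {0<..} z \<partial>lborel)"
    by (subst nn_integral_add[symmetric]) (auto simp: distrib_right)
  finally show ?thesis .
qed

text \<open>Reflection makes both halves contribute equally. The negative half-line is singled out
  because the substitution used later is increasing there.\<close>

lemma nn_integral_even:
  fixes f :: "real \<Rightarrow> ennreal"
  assumes [measurable]: "f \<in> borel_measurable borel" and even: "\<And>z. f (- z) = f z"
  shows "(\<integral>\<^sup>+z. 2 * f z * indicator {..<0} z \<partial>lborel) = (\<integral>\<^sup>+z. f z \<partial>lborel)"
proof -
  have "(\<integral>\<^sup>+z. 2 * f z * indicator {..<0} z \<partial>lborel) = (\<integral>\<^sup>+z. 2 * f z * indicator {0<..} z \<partial>lborel)"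
    by (subst nn_integral_fold) (auto simp: even indicator_def intro!: nn_integral_cong)
  also have "\<dots> = (\<integral>\<^sup>+z. f z \<partial>lborel)"
    by (subst (2) nn_integral_fold) (auto simp: even mult_2 intro!: nn_integral_cong)
  finally show ?thesis .
qed

text \<open>The integrand is \<open>sqrt (pi / b)\<close> times the centred normal density of
  variance \<open>1 / (2 * b)\<close>, which has total mass one.\<close>

lemma nn_integral_gaussian:
  assumes "b > 0"
  shows "(\<integral>\<^sup>+w. ennreal (exp (- (b * w\<^sup>2))) \<partial>lborel) = ennreal (sqrt (pi / b))"
proof -
  define \<sigma> where "\<sigma> = sqrt (1 / (2 * b))"
  have \<sigma>: "\<sigma> > 0" "\<sigma>\<^sup>2 = 1 / (2 * b)" using assms by (auto simp: \<sigma>_def)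
  have "exp (- (b * w\<^sup>2)) = sqrt (pi / b) * normal_density 0 \<sigma> w" for w
    using assms by (simp add: normal_density_def \<sigma>(2) field_simps)
  then have "(\<integral>\<^sup>+w. ennreal (exp (- (b * w\<^sup>2))) \<partial>lborel) =
      ennreal (sqrt (pi / b)) * (\<integral>\<^sup>+w. ennreal (normal_density 0 \<sigma> w) \<partial>lborel)"
    using assms by (simp add: ennreal_mult normal_density_nonneg nn_integral_cmult)
  also have "(\<integral>\<^sup>+w. ennreal (normal_density 0 \<sigma> w) \<partial>lborel) = 1"
    using \<sigma>(1) by (simp add: nn_integral_eq_integral normal_density_nonneg)
  finally show ?thesis by simp
qed

lemma nn_integral_exp_atLeast:
  fixes K c :: real
  assumes "K > 0"
  shows "(\<integral>\<^sup>+b. ennreal (exp (- (b * K))) * indicator {c..} b \<partial>lborel) = ennreal (exp (- (c * K)) / K)"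
proof -
  have "(\<integral>\<^sup>+b. ennreal (exp (- (b * K))) * indicator {c..} b \<partial>lborel) =
      0 - (- exp (- (c * K)) / K)"
  proof (rule nn_integral_FTC_atLeast)
    show "((\<lambda>b. - exp (- (b * K)) / K) \<longlongrightarrow> 0) at_top"
      using assms by real_asymp
    show "((\<lambda>b. - exp (- (b * K)) / K) has_real_derivative exp (- (b * K))) (at b)" for b
      using assms by (auto intro!: derivative_eq_intros)
  qed auto
  then show ?thesis by simp
qed

text \<open>With \<open>K = 1 + w^2\<close>, the left integrand is itself an integral over
  \<open>b \<ge> c\<close>. After the exchange, the integral in \<open>w\<close> for fixed
  \<open>b\<close> is a Gaussian over half the line, doubled. Working in \<open>ennreal\<close>
  makes the exchange free of integrability conditions.\<close>

lemma nn_integral_exp_quadratic_over_quadratic: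
  assumes "c > 0"
  shows "(\<integral>\<^sup>+w. ennreal (2 * exp (- (c * (1 + w\<^sup>2))) / (1 + w\<^sup>2)) * indicator {..<0} w \<partial>lborel) =
         (\<integral>\<^sup>+b. ennreal (exp (- b) * sqrt (pi / b)) * indicator {c..} b \<partial>lborel)"
proof -
  have K: "1 + w\<^sup>2 > 0" for w :: real by (simp add: add_pos_nonneg)
  let ?g = "\<lambda>w b. ennreal (2 * exp (- (b * (1 + w\<^sup>2)))) * indicator {..<0} w * indicator {c..} b"
  have "(\<integral>\<^sup>+w. ennreal (2 * exp (- (c * (1 + w\<^sup>2))) / (1 + w\<^sup>2)) * indicator {..<0} w \<partial>lborel) =
      (\<integral>\<^sup>+w. (\<integral>\<^sup>+b. ?g w b \<partial>lborel) \<partial>lborel)"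
  proof (rule nn_integral_cong)
    fix w :: real
    have "(\<integral>\<^sup>+b. ?g w b \<partial>lborel) =
        2 * indicator {..<0} w * (\<integral>\<^sup>+b. ennreal (exp (- (b * (1 + w\<^sup>2)))) * indicator {c..} b \<partial>lborel)"
      by (subst nn_integral_cmult[symmetric])
        (auto simp: ennreal_mult mult_ac intro!: nn_integral_cong)
    also have "\<dots> = ennreal (2 * exp (- (c * (1 + w\<^sup>2))) / (1 + w\<^sup>2)) * indicator {..<0} w"
      by (subst nn_integral_exp_atLeast[OF K])
        (simp add: ennreal_mult mult_ac less_imp_le[OF K] flip: times_divide_eq_right)
    finally show "ennreal (2 * exp (- (c * (1 + w\<^sup>2))) / (1 + w\<^sup>2)) * indicator {..<0} w =
        (\<integral>\<^sup>+b. ?g w b \<partial>lborel)" by simp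
  qed
  also have "\<dots> = (\<integral>\<^sup>+b. (\<integral>\<^sup>+w. ?g w b \<partial>lborel) \<partial>lborel)"
    by (rule lborel_pair.Fubini') measurable
  also have "\<dots> = (\<integral>\<^sup>+b. ennreal (exp (- b) * sqrt (pi / b)) * indicator {c..} b \<partial>lborel)"
  proof (rule nn_integral_cong)
    fix b :: real
    show "(\<integral>\<^sup>+w. ?g w b \<partial>lborel) = ennreal (exp (- b) * sqrt (pi / b)) * indicator {c..} b"
    proof (cases "c \<le> b")
      case True
      with assms have b: "b > 0" by simp
      have "(\<integral>\<^sup>+w. ?g w b \<partial>lborel) =
          (\<integral>\<^sup>+w. 2 * ennreal (exp (- b) * exp (- (b * w\<^sup>2))) * indicator {..<0} w \<partial>lborel)"
        using True by (intro nn_integral_cong) (simp add: ennreal_mult algebra_simps flip: exp_add)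
      also have "\<dots> = (\<integral>\<^sup>+w. ennreal (exp (- b)) * ennreal (exp (- (b * w\<^sup>2))) \<partial>lborel)"
        by (subst nn_integral_even) (auto simp: ennreal_mult)
      also have "\<dots> = ennreal (exp (- b) * sqrt (pi / b))"
        using b by (simp add: nn_integral_cmult nn_integral_gaussian ennreal_mult)
      finally show ?thesis using True by simp
    qed simp
  qed
  finally show ?thesis .
qed

text \<open>Passage from \<open>ennreal\<close> to Bochner integrals: since
  \<open>1 + w^2 \<ge> 1\<close> and \<open>c > 0\<close>, the quadratic side is dominated by twice
  a Gaussian, and finiteness carries over to the tail in \<open>b\<close> by the equality.\<close>

lemma set_integral_exp_quadratic_over_quadratic:
  assumes "c > 0"
  shows "set_integrable lborel {..<0} (\<lambda>w::real. 2 * exp (- (c * (1 + w\<^sup>2))) / (1 + w\<^sup>2))"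
    and "set_integrable lborel {c<..} (\<lambda>b. exp (- b) * sqrt (pi / b))"
    and "(LBINT w:{..<0}. 2 * exp (- (c * (1 + w\<^sup>2))) / (1 + w\<^sup>2)) =
         (LBINT b:{c<..}. exp (- b) * sqrt (pi / b))"
proof -
  have K: "1 + w\<^sup>2 > 0" for w :: real by (simp add: add_pos_nonneg)
  let ?f = "\<lambda>w::real. indicator {..<0} w *\<^sub>R (2 * exp (- (c * (1 + w\<^sup>2))) / (1 + w\<^sup>2))"
  let ?g = "\<lambda>b. indicator {c<..} b *\<^sub>R (exp (- b) * sqrt (pi / b))"
  \<comment> \<open>Dropping the endpoint \<open>c\<close> gives the open ray, the form in which
    integrals up to infinity appear below.\<close>
  have "AE b in lborel. b \<noteq> c" by (rule AE_lborel_singleton)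
  then have "(\<integral>\<^sup>+b. ennreal (?g b) \<partial>lborel) =
      (\<integral>\<^sup>+b. ennreal (exp (- b) * sqrt (pi / b)) * indicator {c..} b \<partial>lborel)"
    by (intro nn_integral_cong_AE) (auto elim!: eventually_mono simp: indicator_def)
  also have "\<dots> = (\<integral>\<^sup>+w. ennreal (?f w) \<partial>lborel)"
    by (subst nn_integral_exp_quadratic_over_quadratic[OF assms, symmetric])
      (auto simp: indicator_def intro!: nn_integral_cong)
  finally have eq: "(\<integral>\<^sup>+b. ennreal (?g b) \<partial>lborel) = (\<integral>\<^sup>+w. ennreal (?f w) \<partial>lborel)" .
  have "ennreal (?f w) \<le> 2 * ennreal (exp (- (c * w\<^sup>2)))" for w
  proof -
    have "2 * exp (- (c * (1 + w\<^sup>2))) / (1 + w\<^sup>2) \<le> 2 * exp (- (c * (1 + w\<^sup>2))) / 1"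
      using K[of w] by (intro divide_left_mono) auto
    also have "\<dots> \<le> 2 * exp (- (c * w\<^sup>2))" using assms by (simp add: algebra_simps)
    finally have "?f w \<le> 2 * exp (- (c * w\<^sup>2))" by (simp add: indicator_def)
    then show ?thesis by (metis ennreal_leI ennreal_mult' ennreal_numeral exp_ge_zero zero_le_numeral)
  qed
  then have "(\<integral>\<^sup>+w. ennreal (?f w) \<partial>lborel) \<le> (\<integral>\<^sup>+w. 2 * ennreal (exp (- (c * w\<^sup>2))) \<partial>lborel)"
    by (rule nn_integral_mono)
  also have "\<dots> < \<infinity>"
    using assms by (simp add: nn_integral_cmult nn_integral_gaussian ennreal_mult_less_top)
  finally have fin: "(\<integral>\<^sup>+w. ennreal (?f w) \<partial>lborel) < \<infinity>" .
  have f0: "0 \<le> ?f w" for w using K[of w] by simp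
  have g0: "0 \<le> ?g b" for b using assms by (simp add: indicator_def)
  show "set_integrable lborel {..<0} (\<lambda>w::real. 2 * exp (- (c * (1 + w\<^sup>2))) / (1 + w\<^sup>2))"
    unfolding set_integrable_def using fin f0 by (intro integrableI_nonneg AE_I2) auto
  show "set_integrable lborel {c<..} (\<lambda>b. exp (- b) * sqrt (pi / b))"
    unfolding set_integrable_def using fin g0 eq by (intro integrableI_nonneg AE_I2) auto
  show "(LBINT w:{..<0}. 2 * exp (- (c * (1 + w\<^sup>2))) / (1 + w\<^sup>2)) =
      (LBINT b:{c<..}. exp (- b) * sqrt (pi / b))"
    unfolding set_lebesgue_integral_def
    by (subst (1 2) integral_eq_nn_integral) (use f0 g0 eq in auto)
qed

text \<open>The tail beyond \<open>x\<close> is the fixed tail beyond \<open>c\<close> minus the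
  integral from \<open>c\<close> to \<open>x\<close>, so the fundamental theorem of calculus is
  applied on a compact interval only.\<close>

lemma has_derivative_upper_tail:
  assumes "c > 0"
  shows "((\<lambda>c. LBINT b:{c<..}. exp (- b) * sqrt (pi / b)) has_real_derivative
           - (exp (- c) * sqrt (pi / c))) (at c)"
proof -
  let ?f = "\<lambda>b. exp (- b) * sqrt (pi / b)"
  \<comment> \<open>The interval has \<open>c\<close> in its interior and stays away from the
    singularity of \<open>sqrt (pi / b)\<close> at 0.\<close>
  have "continuous_on {c / 2..c + 1} ?f"
    using assms by (intro continuous_intros) auto
  then have "((\<lambda>x. LBINT b=c..x. ?f b) has_vector_derivative ?f c) (at c within {c / 2..c + 1})"
    using assms by (intro interval_integral_FTC2) auto
  then have "((\<lambda>x. LBINT b=c..x. ?f b) has_real_derivative ?f c) (at c)"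
    using assms by (simp add: at_within_Icc_at has_real_derivative_iff_has_vector_derivative)
  then have "((\<lambda>x. (LBINT b:{c<..}. ?f b) - (LBINT b=c..x. ?f b)) has_real_derivative - ?f c) (at c)"
    by (auto intro!: derivative_eq_intros)
  then show ?thesis
  proof (rule has_field_derivative_transform_within_open)
    fix x :: real assume "x \<in> {0<..}"
    \<comment> \<open>Starting at the smaller endpoint treats \<open>x\<close> on either side of
      \<open>c\<close> at once.\<close>
    then have "interval_lebesgue_integrable lborel (min c x) \<infinity> ?f"
      using set_integral_exp_quadratic_over_quadratic(2)[of "min c x"] assms
      by (simp add: interval_integrable_to_infinity_eq del: ereal_min)
    then have "interval_lebesgue_integrable lborel (min (ereal c) (min (ereal x) \<infinity>))
        (max (ereal c) (max (ereal x) \<infinity>)) ?f"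
      by (simp add: max_def min_def split: if_splits)
    from interval_integral_sum[OF this]
    show "(LBINT b:{c<..}. ?f b) - (LBINT b=c..x. ?f b) = (LBINT b:{x<..}. ?f b)"
      by (simp add: interval_integral_to_infinity_eq)
  qed (use assms in auto)
qed

section \<open>The half integral of the driftless kernel and its derivative\<close>

lemma half_integral_heat_kernel:
  fixes a u :: real
  assumes "a > 0" "u > 0"
  shows "set_integrable lborel {0<..<u} (\<lambda>s. exp (- (a\<^sup>2 / (4 * s))) / sqrt s * (u - s) powr (- 1 / 2))"
    and "(LBINT s:{0<..<u}. exp (- (a\<^sup>2 / (4 * s))) / sqrt s * (u - s) powr (- 1 / 2)) =
         (LBINT b:{a\<^sup>2 / (4 * u)<..}. exp (- b) * sqrt (pi / b))"
proof -
  define f where "f = (\<lambda>s. exp (- (a\<^sup>2 / (4 * s))) / sqrt s * (u - s) powr (- 1 / 2))"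
  \<comment> \<open>Under \<open>s = g w\<close> the exponent \<open>a^2 / (4 * s)\<close> becomes
    \<open>c * (1 + w^2)\<close>, and \<open>u - s\<close> becomes
    \<open>u * w^2 / (1 + w^2)\<close>, whose inverse square root cancels the factor
    \<open>w\<close> in \<open>g'\<close>. As \<open>w\<close> runs from minus infinity to 0,
    \<open>g\<close> increases from 0 to \<open>u\<close>.\<close>
  define g where "g = (\<lambda>w::real. u / (1 + w\<^sup>2))"
  define g' where "g' = (\<lambda>w::real. - (2 * u * w) / (1 + w\<^sup>2)\<^sup>2)"
  define c where "c = a\<^sup>2 / (4 * u)"
  have K: "1 + w\<^sup>2 > 0" for w :: real by (simp add: add_pos_nonneg)
  then have K0: "1 + w\<^sup>2 \<noteq> 0" for w :: real by (metis less_irrefl)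
  have c: "c > 0" using assms by (simp add: c_def)
  have eq: "f (g w) * g' w = 2 * exp (- (c * (1 + w\<^sup>2))) / (1 + w\<^sup>2)" if "w < 0" for w
  proof -
    let ?k = "sqrt (1 + w\<^sup>2)"
    have k: "?k > 0" "?k\<^sup>2 = 1 + w\<^sup>2" using K[of w] by simp_all
    have "u - g w = u * w\<^sup>2 / (1 + w\<^sup>2)" using K0[of w] by (simp add: g_def field_simps)
    moreover have "(u * w\<^sup>2 / (1 + w\<^sup>2)) powr (- 1 / 2) = 1 / sqrt (u * w\<^sup>2 / (1 + w\<^sup>2))"
      using assms K[of w] powr_minus_divide[of "u * w\<^sup>2 / (1 + w\<^sup>2)" "1 / 2"]
      by (simp add: powr_half_sqrt)
    \<comment> \<open>For \<open>w < 0\<close> the root of \<open>w^2\<close> is \<open>- w\<close>;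
      this sign cancels the one in \<open>g'\<close>.\<close>
    ultimately have p: "(u - g w) powr (- 1 / 2) = ?k / (sqrt u * - w)"
      using that by (simp add: real_sqrt_mult real_sqrt_divide)
    have q: "sqrt (g w) = sqrt u / ?k" by (simp add: g_def real_sqrt_divide)
    have r: "a\<^sup>2 / (4 * g w) = c * (1 + w\<^sup>2)"
      using assms by (simp add: g_def c_def)
    have alg: "X / (z / k) * (k / (z * - w)) * (- (2 * u * w) / K\<^sup>2) = 2 * X / K"
      if "k\<^sup>2 = K" "z\<^sup>2 = u" "k > 0" for X z k K :: real
    proof -
      have "z \<noteq> 0" using that assms by auto
      with \<open>w < 0\<close> \<open>k > 0\<close> show ?thesis
        unfolding that(1,2)[symmetric] by (simp add: power2_eq_square)
    qed
    show ?thesis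
      unfolding f_def g'_def p q r by (rule alg) (use k assms in auto)
  qed
  have g: "g w > 0" "w < 0 \<Longrightarrow> g w < u" for w
    using assms K[of w] by (auto simp: g_def field_simps)
  have int: "set_integrable lborel {..<0} (\<lambda>w. f (g w) * g' w)"
    using set_integral_exp_quadratic_over_quadratic(1)[OF c]
    by (rule set_integrable_cong[THEN iffD1, rotated -1]) (auto simp: eq)
  have ein: "einterval (- \<infinity>) 0 = {..<0}" "einterval 0 (ereal u) = {0<..<u}"
    by (auto simp: einterval_def zero_ereal_def)
  have cont_f: "isCont f (g w)" if "ereal w < 0" for w
  proof -
    from that have "w < 0" by (simp add: zero_ereal_def)
    with g[of w] show ?thesis unfolding f_def by (intro continuous_intros) auto
  qed
  have deriv_g: "DERIV g w :> g' w" for w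
    unfolding g_def g'_def using K0[of w]
    by (auto intro!: derivative_eq_intros simp: power2_eq_square)
  have cont_g': "isCont g' w" for w
    unfolding g'_def using K0[of w] by (intro continuous_intros) auto
  have g'_nonneg: "0 \<le> g' w" if "ereal w \<le> 0" for w
    using that assms by (simp add: g'_def divide_le_0_iff mult_le_0_iff zero_ereal_def)
  have "(g \<longlongrightarrow> 0) at_bot" unfolding g_def by real_asymp
  then have lim_bot: "((ereal \<circ> g \<circ> real_of_ereal) \<longlongrightarrow> 0) (at_right (- \<infinity>))"
    by (simp add: ereal_tendsto_simps zero_ereal_def)
  have "(g \<longlongrightarrow> u) (at_left 0)"
    unfolding g_def by (auto intro!: tendsto_eq_intros)
  then have lim_0: "((ereal \<circ> g \<circ> real_of_ereal) \<longlongrightarrow> ereal u) (at_left 0)"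
    by (simp add: ereal_tendsto_simps zero_ereal_def)
  have f_nonneg: "0 \<le> f (g w)" for w
    using g(1)[of w] by (simp add: f_def)
  \<comment> \<open>For nonnegative integrands the substitution rule also transfers integrability,
    so it yields both claims. The endpoints enter only through the limits of
    \<open>g\<close>.\<close>
  note substitution = interval_integral_substitution_nonneg[of "- \<infinity>" 0 g g' f,
      OF _ deriv_g cont_f cont_g' f_nonneg g'_nonneg lim_bot lim_0, unfolded ein, OF _ _ _ int]
  have f: "set_integrable lborel {0<..<u} f"
      "(LBINT s:{0<..<u}. f s) = (LBINT w:{..<0}. f (g w) * g' w)"
    using substitution assms by (simp_all add: ein interval_lebesgue_integral_le_eq)
  note f(2)
  also have "(LBINT w:{..<0}. f (g w) * g' w) =
      (LBINT w:{..<0}. 2 * exp (- (c * (1 + w\<^sup>2))) / (1 + w\<^sup>2))"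
    by (rule set_lebesgue_integral_cong) (auto simp: eq)
  also have "\<dots> = (LBINT b:{c<..}. exp (- b) * sqrt (pi / b))"
    by (rule set_integral_exp_quadratic_over_quadratic[OF c])
  finally show "(LBINT s:{0<..<u}. exp (- (a\<^sup>2 / (4 * s))) / sqrt s * (u - s) powr (- 1 / 2)) =
      (LBINT b:{a\<^sup>2 / (4 * u)<..}. exp (- b) * sqrt (pi / b))"
    by (simp add: f_def c_def)
  show "set_integrable lborel {0<..<u} (\<lambda>s. exp (- (a\<^sup>2 / (4 * s))) / sqrt s * (u - s) powr (- 1 / 2))"
    using f(1) by (simp add: f_def)
qed

text \<open>The variable \<open>u\<close> survives only in the lower limit of the tail, so the chain
  rule applies; that limit decreases in \<open>u\<close>, and the two minus signs cancel.\<close>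

lemma has_derivative_half_integral_heat_kernel:
  fixes a t :: real
  assumes "a > 0" "t > 0"
  shows "((\<lambda>u. LBINT s:{0<..<u}. exp (- (a\<^sup>2 / (4 * s))) / sqrt s * (u - s) powr (- 1 / 2))
           has_real_derivative a * sqrt (pi * t) / (2 * t\<^sup>2) * exp (- (a\<^sup>2 / (4 * t)))) (at t)"
proof -
  have "((\<lambda>u. a\<^sup>2 / (4 * u)) has_real_derivative - (a\<^sup>2 / (4 * t\<^sup>2))) (at t)"
    using assms by (auto intro!: derivative_eq_intros simp: power2_eq_square)
  from DERIV_chain2[OF has_derivative_upper_tail this]
  have "((\<lambda>u. LBINT b:{a\<^sup>2 / (4 * u)<..}. exp (- b) * sqrt (pi / b)) has_real_derivative
      - (exp (- (a\<^sup>2 / (4 * t))) * sqrt (pi / (a\<^sup>2 / (4 * t)))) * - (a\<^sup>2 / (4 * t\<^sup>2))) (at t)"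
    using assms by simp
  also have "- (exp (- (a\<^sup>2 / (4 * t))) * sqrt (pi / (a\<^sup>2 / (4 * t)))) * - (a\<^sup>2 / (4 * t\<^sup>2)) =
      a * sqrt (pi * t) / (2 * t\<^sup>2) * exp (- (a\<^sup>2 / (4 * t)))"
    using assms by (simp add: real_sqrt_mult real_sqrt_divide power2_eq_square)
  finally show ?thesis
  proof (rule has_field_derivative_transform_within_open)
    show "open {0::real<..}" by simp
  qed (use assms half_integral_heat_kernel in auto)
qed

section \<open>The tempered fractional equation\<close>

lemma drift_density_cosh:
  assumes "s > 0"
  shows "drift_density \<mu> x y s =
    exp (- (\<mu>\<^sup>2 / 4 * s)) * cosh (\<mu> / 2 * (y - x)) / sqrt (pi * s) * exp (- ((y - x)\<^sup>2 / (4 * s)))"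
proof -
  have e: "- ((y - x - \<mu> * s)\<^sup>2 / (4 * s)) = - (\<mu>\<^sup>2 / 4 * s) + \<mu> / 2 * (y - x) - (y - x)\<^sup>2 / (4 * s)"
    "- ((y - x + \<mu> * s)\<^sup>2 / (4 * s)) = - (\<mu>\<^sup>2 / 4 * s) - \<mu> / 2 * (y - x) - (y - x)\<^sup>2 / (4 * s)"
    using assms by (simp_all add: field_simps power2_eq_square)
  have "sqrt (4 * pi * s) = 2 * sqrt (pi * s)" by (simp add: real_sqrt_mult)
  then show ?thesis
    unfolding drift_density_def e cosh_def exp_diff exp_add
    by (simp only: exp_minus divide_inverse) (simp add: algebra_simps)
qed

text \<open>Tempering cancels the exponential damping due to the drift, leaving a factor constant in
  \<open>s\<close> times the driftless kernel.\<close>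

lemma exp_drift_density:
  assumes "s > 0"
  shows "exp (\<mu>\<^sup>2 / 4 * s) * drift_density \<mu> x y s =
    cosh (\<mu> / 2 * (y - x)) / sqrt pi * (exp (- ((y - x)\<^sup>2 / (4 * s))) / sqrt s)"
  using assms by (simp add: drift_density_cosh exp_minus real_sqrt_mult)

lemma half_deriv_exp_drift_density:
  fixes \<mu> x y t :: real
  assumes "x < y" "t > 0"
  defines "a \<equiv> y - x" and "f \<equiv> (\<lambda>s. exp (\<mu>\<^sup>2 / 4 * s) * drift_density \<mu> x y s)"
  shows "RL_half_differentiable f t"
    and "RL_half_deriv f t = cosh (\<mu> / 2 * a) * a / (2 * t * sqrt (pi * t)) * exp (- (a\<^sup>2 / (4 * t)))"
proof -
  define C where "C = cosh (\<mu> / 2 * a) / sqrt pi"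
  define k where "k = (\<lambda>s. exp (- (a\<^sup>2 / (4 * s))) / sqrt s)"
  have a: "a > 0" using assms by (simp add: a_def)
  have f: "f s = C * k s" if "s > 0" for s
    using exp_drift_density[OF that] by (simp add: f_def C_def k_def a_def)
  \<comment> \<open>For \<open>u \<le> 0\<close> the domain is empty, so integrability holds for
    every \<open>u\<close>, in particular near \<open>t\<close>.\<close>
  have int: "set_integrable lborel {0<..<u} (\<lambda>s. f s * (u - s) powr (- 1 / 2))" for u
  proof (cases "u > 0")
    case True
    have "set_integrable lborel {0<..<u} (\<lambda>s. C * (k s * (u - s) powr (- 1 / 2)))"
      using half_integral_heat_kernel(1)[OF a True]
      unfolding k_def by (rule set_integrable_mult_right)
    then show ?thesis
      by (rule set_integrable_cong[THEN iffD1, rotated -1]) (auto simp: f)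
  qed (simp add: set_integrable_def)
  have eq: "(LBINT s:{0<..<u}. f s * (u - s) powr (- 1 / 2)) =
      C * (LBINT s:{0<..<u}. k s * (u - s) powr (- 1 / 2))" for u
    unfolding set_integral_mult_right[symmetric]
    by (rule set_lebesgue_integral_cong) (auto simp: f)
  have deriv: "((\<lambda>u. LBINT s:{0<..<u}. f s * (u - s) powr (- 1 / 2)) has_real_derivative
      C * (a * sqrt (pi * t) / (2 * t\<^sup>2) * exp (- (a\<^sup>2 / (4 * t))))) (at t)"
    unfolding eq unfolding k_def
    by (intro DERIV_cmult has_derivative_half_integral_heat_kernel a assms)
  show "RL_half_differentiable f t"
    using int deriv by (auto simp: RL_half_differentiable_def field_differentiable_def)
  \<comment> \<open>Collecting constants: one \<open>1 / sqrt pi\<close> is the normalization of the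
    half derivative, the other comes from \<open>C\<close>.\<close>
  have "1 / p * (1 / p) * (p * q) / q\<^sup>2 = 1 / (p * q)" for p q :: real
    by (simp add: power2_eq_square)
  from this[of "sqrt pi" "sqrt t"]
  have r: "1 / sqrt pi * (1 / sqrt pi) * sqrt (pi * t) / t = 1 / sqrt (pi * t)"
    using assms by (simp add: real_sqrt_mult)
  have "1 / p * (h / p * (a * z / (2 * t\<^sup>2) * e)) = h * a / (2 * t) * e * (1 / p * (1 / p) * z / t)"
    for p h z e :: real
    by (simp add: power2_eq_square mult_ac)
  then have "RL_half_deriv f t =
      cosh (\<mu> / 2 * a) * a / (2 * t) * exp (- (a\<^sup>2 / (4 * t))) * (1 / sqrt pi * (1 / sqrt pi) * sqrt (pi * t) / t)"
    unfolding RL_half_deriv_def DERIV_imp_deriv[OF deriv] C_def .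
  then show "RL_half_deriv f t =
      cosh (\<mu> / 2 * a) * a / (2 * t * sqrt (pi * t)) * exp (- (a\<^sup>2 / (4 * t)))"
    unfolding r by simp
qed

text \<open>Differentiating the factored \<open>cosh\<close> form, not the sum of two Gaussians,
  separates the \<open>sinh\<close> term from the \<open>cosh\<close> term as the equation
  requires.\<close>

lemma has_derivative_drift_density:
  assumes "t > 0"
  shows "((\<lambda>w. drift_density \<mu> x w t) has_real_derivative
     exp (- (\<mu>\<^sup>2 / 4 * t)) / sqrt (pi * t) * exp (- ((y - x)\<^sup>2 / (4 * t))) *
       (\<mu> / 2 * sinh (\<mu> / 2 * (y - x)) - cosh (\<mu> / 2 * (y - x)) * (y - x) / (2 * t))) (at y)"
proof -
  have "((\<lambda>w. exp (- ((w - x)\<^sup>2 / (4 * t)))) has_real_derivative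
      exp (- ((y - x)\<^sup>2 / (4 * t))) * - ((y - x) / (2 * t))) (at y)"
    using assms by (auto intro!: derivative_eq_intros simp: divide_simps)
  moreover have "((\<lambda>w. cosh (\<mu> / 2 * (w - x))) has_real_derivative
      sinh (\<mu> / 2 * (y - x)) * (\<mu> / 2)) (at y)"
    by (auto intro!: derivative_eq_intros)
  ultimately have "((\<lambda>w. exp (- (\<mu>\<^sup>2 / 4 * t)) / sqrt (pi * t) *
      (cosh (\<mu> / 2 * (w - x)) * exp (- ((w - x)\<^sup>2 / (4 * t))))) has_real_derivative
      exp (- (\<mu>\<^sup>2 / 4 * t)) / sqrt (pi * t) *
      (sinh (\<mu> / 2 * (y - x)) * (\<mu> / 2) * exp (- ((y - x)\<^sup>2 / (4 * t))) +
       exp (- ((y - x)\<^sup>2 / (4 * t))) * - ((y - x) / (2 * t)) * cosh (\<mu> / 2 * (y - x)))) (at y)"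
    by (intro DERIV_cmult DERIV_mult)
  moreover have "drift_density \<mu> x w t = exp (- (\<mu>\<^sup>2 / 4 * t)) / sqrt (pi * t) *
      (cosh (\<mu> / 2 * (w - x)) * exp (- ((w - x)\<^sup>2 / (4 * t))))" for w
    using assms by (simp add: drift_density_cosh)
  moreover have "A * (S * m * X + X * - (d / T) * C) = A * X * (m * S - C * d / T)"
    for A S m X d T C :: real
    by (simp add: algebra_simps)
  ultimately show ?thesis by (simp only:)
qed

text \<open>With the common factor \<open>E\<close>, the \<open>cosh\<close> part of the
  \<open>y\<close>-derivative matches the half derivative, the \<open>sinh\<close> part cancels the
  \<open>tanh\<close> term, and \<open>\<mu> > 0\<close> identifies
  \<open>sqrt (\<mu>^2 / 4)\<close> with \<open>\<mu> / 2\<close> in the remaining terms.\<close>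

lemma tempered_equation_drift_density:
  assumes "\<mu> > 0" "x < y" "t > 0"
  shows "tempered_half_deriv (\<mu>\<^sup>2 / 4) (\<lambda>s. drift_density \<mu> x y s) t =
    - deriv (\<lambda>w. drift_density \<mu> x w t) y
    + drift_density \<mu> x y t * (\<mu> / 2) * tanh (\<mu> / 2 * (y - x))
    - \<mu> / 2 * drift_density \<mu> x y t"
proof -
  let ?a = "y - x"
  define E where "E = exp (- (\<mu>\<^sup>2 / 4 * t)) / sqrt (pi * t) * exp (- (?a\<^sup>2 / (4 * t)))"
  have v: "drift_density \<mu> x y t = E * cosh (\<mu> / 2 * ?a)"
    using assms by (simp add: drift_density_cosh E_def)
  have d: "deriv (\<lambda>w. drift_density \<mu> x w t) y =
      E * (\<mu> / 2 * sinh (\<mu> / 2 * ?a) - cosh (\<mu> / 2 * ?a) * ?a / (2 * t))"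
    unfolding E_def by (rule DERIV_imp_deriv has_derivative_drift_density assms)+
  have h: "exp (- (\<mu>\<^sup>2 / 4 * t)) * RL_half_deriv (\<lambda>s. exp (\<mu>\<^sup>2 / 4 * s) * drift_density \<mu> x y s) t =
      E * cosh (\<mu> / 2 * ?a) * ?a / (2 * t)"
    unfolding half_deriv_exp_drift_density(2)[OF assms(2,3)] by (simp add: E_def mult_ac)
  have "cosh (\<mu> / 2 * ?a) * tanh (\<mu> / 2 * ?a) = sinh (\<mu> / 2 * ?a)"
    by (simp add: tanh_def)
  then have th: "drift_density \<mu> x y t * (\<mu> / 2) * tanh (\<mu> / 2 * ?a) = E * (\<mu> / 2) * sinh (\<mu> / 2 * ?a)"
    unfolding v by (simp add: mult_ac)
  have "sqrt (\<mu>\<^sup>2 / 4) = \<mu> / 2" using assms by (simp add: real_sqrt_divide)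
  then show ?thesis unfolding tempered_half_deriv_def h d th by (simp add: v algebra_simps)
qed

section \<open>The law of the reflected process\<close>

lemma (in prob_space) distributed_abs:
  fixes X :: "'a \<Rightarrow> real" and f :: "real \<Rightarrow> ennreal"
  assumes X: "distributed M lborel X f"
  shows "distributed M lborel (\<lambda>\<omega>. \<bar>X \<omega>\<bar>) (\<lambda>y. (f y + f (- y)) * indicator {0<..} y)"
proof -
  have [measurable]: "f \<in> borel_measurable borel" "random_variable borel X"
    using X by (auto simp: distributed_def)
  have "distr M lborel (\<lambda>\<omega>. \<bar>X \<omega>\<bar>) = density lborel (\<lambda>y. (f y + f (- y)) * indicator {0<..} y)"
  proof (rule measure_eqI)
    fix A assume "A \<in> sets (distr M lborel (\<lambda>\<omega>. \<bar>X \<omega>\<bar>))"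
    then have [measurable]: "A \<in> sets borel" by simp
    have "emeasure (distr M lborel (\<lambda>\<omega>. \<bar>X \<omega>\<bar>)) A = (\<integral>\<^sup>+\<omega>. indicator A \<bar>X \<omega>\<bar> \<partial>M)"
      by (subst nn_integral_indicator[symmetric], simp) (subst nn_integral_distr, auto)
    also have "\<dots> = (\<integral>\<^sup>+z. f z * indicator A \<bar>z\<bar> \<partial>lborel)"
      by (subst distributed_nn_integral[OF X]) auto
    \<comment> \<open>Folding pairs \<open>z\<close> with \<open>- z\<close>, which have the same
      absolute value.\<close>
    also have "\<dots> = (\<integral>\<^sup>+z. (f z + f (- z)) * indicator {0<..} z * indicator A z \<partial>lborel)"
      by (subst nn_integral_fold) (auto simp: indicator_def intro!: nn_integral_cong)
    also have "\<dots> = emeasure (density lborel (\<lambda>y. (f y + f (- y)) * indicator {0<..} y)) A"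
      by (subst emeasure_density) auto
    finally show "emeasure (distr M lborel (\<lambda>\<omega>. \<bar>X \<omega>\<bar>)) A =
        emeasure (density lborel (\<lambda>y. (f y + f (- y)) * indicator {0<..} y)) A" .
  qed simp
  then show ?thesis by (simp add: distributed_def)
qed

text \<open>Folding the normal density with mean \<open>\<mu> * t\<close> produces the two summands
  of \<open>drift_density\<close>. Stated for any Gaussian \<open>X\<close>, it serves both the
  Brownian marginal and the standard normal model behind the initial condition.\<close>

lemma (in prob_space) distributed_reflected_drift:
  assumes X: "distributed M lborel X (normal_density 0 (sqrt (2 * t)))" and t: "t > 0"
  shows "distributed M lborel (\<lambda>\<omega>. \<bar>X \<omega> + \<mu> * t\<bar> + x)
           (\<lambda>y. ennreal (if x < y then drift_density \<mu> x y t else 0))"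
proof -
  let ?n = "normal_density (\<mu> * t) (sqrt (2 * t))"
  have "distributed M lborel (\<lambda>\<omega>. \<mu> * t + X \<omega>) ?n"
    using normal_density_affine[OF X, of 1 "\<mu> * t"] t by simp
  from distributed_affine[OF distributed_abs[OF this], of 1 x]
  have "distributed M lborel (\<lambda>\<omega>. \<bar>X \<omega> + \<mu> * t\<bar> + x)
      (\<lambda>y. (ennreal (?n (y - x)) + ennreal (?n (- (y - x)))) * indicator {0<..} (y - x))"
    by (simp add: add.commute divide_ennreal_def)
  moreover have "(ennreal (?n (y - x)) + ennreal (?n (- (y - x)))) * indicator {0<..} (y - x) =
      ennreal (if x < y then drift_density \<mu> x y t else 0)" for y
  proof -
    have "(- (y - x) - \<mu> * t)\<^sup>2 = (y - x + \<mu> * t)\<^sup>2" by (simp add: power2_eq_square algebra_simps)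
    then have "?n (y - x) + ?n (- (y - x)) = drift_density \<mu> x y t"
      using t by (simp add: normal_density_def drift_density_def mult_ac)
    then show ?thesis
      by (auto simp: normal_density_nonneg indicator_def simp flip: ennreal_plus)
  qed
  ultimately show ?thesis by simp
qed

text \<open>The start at 0 is only almost sure, so the law of the increment from time 0 is carried
  over by almost sure equality.\<close>

lemma (in brownian_motion) distributed_B:
  assumes "t > 0"
  shows "distributed M lborel (B t) (normal_density 0 (sqrt (2 * t)))"
proof -
  have [measurable]: "random_variable borel (B t)" "random_variable borel (B 0)"
    using assms by (auto intro!: measurable_B)
  have "distributed M lborel (\<lambda>\<omega>. B t \<omega> - B 0 \<omega>) (normal_density 0 (sqrt (2 * t)))"
    using gaussian_increments[of 0 t] assms by simp
  moreover have "distr M lborel (\<lambda>\<omega>. B t \<omega> - B 0 \<omega>) = distr M lborel (B t)"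
    using start_origin by (intro distr_cong_AE) (auto elim!: eventually_mono)
  ultimately show ?thesis by (simp add: distributed_def)
qed

section \<open>Initial and boundary conditions\<close>

lemma weakly_tends_to_drift_density:
  fixes \<mu> x :: real
  shows "weakly_tends_to (\<lambda>t. density lborel (\<lambda>y. ennreal (if x < y then drift_density \<mu> x y t else 0)))
           (return borel x) (at_right 0)"
proof -
  \<comment> \<open>The law \<open>P\<close> carries all \<open>N t\<close> with
    \<open>t > 0\<close> as images under explicit maps, which turns weak convergence into
    convergence of integrals over one fixed space.\<close>
  define P where "P = density lborel (\<lambda>z. ennreal (std_normal_density z))"
  define N where "N = (\<lambda>t. density lborel (\<lambda>y. ennreal (if x < y then drift_density \<mu> x y t else 0)))"
  interpret P: prob_space P unfolding P_def by (rule prob_space_normal_density) simp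
  have [measurable_cong, simp]: "sets P = sets borel" by (simp add: P_def)
  have "distributed P lborel (\<lambda>z. z) std_normal_density"
    by (simp add: distributed_def P_def distr_id2)
  then have "distributed P lborel (\<lambda>z. sqrt (2 * t) * z) (normal_density 0 (sqrt (2 * t)))"
    if "t > 0" for t
    using P.normal_density_affine[where X = "\<lambda>z. z" and \<mu> = 0 and \<sigma> = 1
        and \<alpha> = "sqrt (2 * t)" and \<beta> = 0] that by simp
  from P.distributed_reflected_drift[OF this]
  have N: "N t = distr P lborel (\<lambda>z. \<bar>sqrt (2 * t) * z + \<mu> * t\<bar> + x)" if "t > 0" for t
    using that by (simp add: N_def distributed_def)
  have fin: "finite_borel_measure (N t)" if "t > 0" for t
  proof -
    interpret prob_space "N t" unfolding N[OF that] by (rule P.prob_space_distr) simp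
    show ?thesis by standard (simp add: N_def)
  qed
  have dirac: "finite_borel_measure (return borel x)"
  proof -
    interpret prob_space "return borel x" by (rule prob_space_return) simp
    show ?thesis by standard simp
  qed
  have lim: "((\<lambda>t. \<integral>y. f y \<partial>N t) \<longlongrightarrow> (\<integral>y. f y \<partial>return borel x)) (at_right 0)"
    if cont: "continuous_on UNIV f" and bdd: "bounded (range f)" for f :: "real \<Rightarrow> real"
  proof -
    have [measurable]: "f \<in> borel_measurable borel"
      using cont by (rule borel_measurable_continuous_onI)
    obtain K where K: "\<And>y. norm (f y) \<le> K" using bdd by (auto simp: bounded_iff)
    \<comment> \<open>The sequence \<open>X\<close> may take negative values: real
      \<open>sqrt\<close> is defined and continuous on the whole line. The constant \<open>K\<close>
      is an integrable bound since \<open>P\<close> is a probability measure.\<close>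
    have "(\<lambda>n. \<integral>z. f (\<bar>sqrt (2 * X n) * z + \<mu> * X n\<bar> + x) \<partial>P) \<longlonglongrightarrow> (\<integral>z. f x \<partial>P)"
      if X: "X \<longlonglongrightarrow> 0" for X
    proof (rule integral_dominated_convergence[where w = "\<lambda>_. K"])
      have "(\<lambda>n. f (\<bar>sqrt (2 * X n) * z + \<mu> * X n\<bar> + x)) \<longlonglongrightarrow> f x" for z
      proof (rule continuous_on_tendsto_compose[OF cont])
        show "(\<lambda>n. \<bar>sqrt (2 * X n) * z + \<mu> * X n\<bar> + x) \<longlonglongrightarrow> x"
          by (rule tendsto_eq_intros X refl)+ simp
      qed auto
      then show "AE z in P. (\<lambda>n. f (\<bar>sqrt (2 * X n) * z + \<mu> * X n\<bar> + x)) \<longlonglongrightarrow> f x" by simp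
    qed (use K in auto)
    then have "((\<lambda>t. \<integral>z. f (\<bar>sqrt (2 * t) * z + \<mu> * t\<bar> + x) \<partial>P) \<longlongrightarrow> (\<integral>z. f x \<partial>P)) (at_right 0)"
      by (auto simp: tendsto_at_iff_sequentially comp_def)
    moreover have "\<forall>\<^sub>F t in at_right 0. (\<integral>z. f (\<bar>sqrt (2 * t) * z + \<mu> * t\<bar> + x) \<partial>P) = (\<integral>y. f y \<partial>N t)"
      unfolding eventually_at_right_field
      by (intro exI[of _ 1]) (auto simp: N integral_distr)
    ultimately have "((\<lambda>t. \<integral>y. f y \<partial>N t) \<longlongrightarrow> (\<integral>z. f x \<partial>P)) (at_right 0)"
      by (rule Lim_transform_eventually)
    also have "(\<integral>z. f x \<partial>P) = (\<integral>y. f y \<partial>return borel x)"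
      by (simp add: P.prob_space integral_return)
    finally show ?thesis .
  qed
  show ?thesis
    using fin dirac lim unfolding weakly_tends_to_def N_def
    by (auto simp: eventually_at_right_field intro: exI[of _ 1])
qed

text \<open>For fixed \<open>t\<close> the formula is continuous in \<open>y\<close> up to
  \<open>y = x\<close>, where the two Gaussian terms coincide.\<close>

lemma tendsto_drift_density_boundary:
  assumes "t > 0"
  shows "((\<lambda>y. drift_density \<mu> x y t) \<longlongrightarrow> exp (- (\<mu>\<^sup>2 / 4 * t)) / sqrt (pi * t)) (at_right x)"
proof -
  have "((\<lambda>y. drift_density \<mu> x y t) \<longlongrightarrow> drift_density \<mu> x x t) (at_right x)"
    unfolding drift_density_def using assms by (intro tendsto_intros) auto
  also have "drift_density \<mu> x x t = exp (- (\<mu>\<^sup>2 / 4 * t)) / sqrt (pi * t)"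
    using assms by (simp add: drift_density_def real_sqrt_mult power2_eq_square)
  finally show ?thesis .
qed

theorem theorem2:
  fixes \<mu> \<eta> :: real
    and v :: "real \<Rightarrow> real \<Rightarrow> real \<Rightarrow> real"
    and M :: "'a measure" and B :: "real \<Rightarrow> 'a \<Rightarrow> real"
  assumes "\<mu> > 0" and "\<eta> = \<mu>\<^sup>2 / 4"
    and "v = drift_density \<mu>"
  shows "(brownian_motion M B \<longrightarrow>
            (\<forall>x>0. \<forall>t>0.
               distributed M lborel (\<lambda>\<omega>. \<bar>B t \<omega> + \<mu> * t\<bar> + x)
                 (\<lambda>y. ennreal (if x < y then v x y t else 0)))) \<and>
         (\<forall>x y t. 0 < x \<and> x < y \<and> 0 < t \<longrightarrow>
            tempered_half_differentiable \<eta> (\<lambda>s. v x y s) t \<and>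
            (\<lambda>w. v x w t) field_differentiable at y \<and>
            tempered_half_deriv \<eta> (\<lambda>s. v x y s) t =
              - deriv (\<lambda>w. v x w t) y
              + v x y t * sqrt \<eta> * tanh (sqrt \<eta> * (y - x))
              - \<mu> / 2 * v x y t) \<and>
         (\<forall>x>0. weakly_tends_to
            (\<lambda>t. density lborel (\<lambda>y. ennreal (if x < y then v x y t else 0)))
            (return borel x) (at_right 0)) \<and>
         (\<forall>x>0. \<forall>t>0.
            ((\<lambda>y. v x y t) \<longlongrightarrow> exp (- (\<eta> * t)) / sqrt (pi * t)) (at_right x))"
proof (intro conjI allI impI)
  fix x t :: real
  assume B: "brownian_motion M B" and t: "0 < t"
  interpret brownian_motion M B by (rule B)
  show "distributed M lborel (\<lambda>\<omega>. \<bar>B t \<omega> + \<mu> * t\<bar> + x)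
      (\<lambda>y. ennreal (if x < y then v x y t else 0))"
    unfolding assms(3) by (intro distributed_reflected_drift distributed_B t)
next
  fix x y t :: real
  assume "0 < x \<and> x < y \<and> 0 < t"
  then have xyt: "x < y" "0 < t" by auto
  have \<eta>: "sqrt \<eta> = \<mu> / 2" unfolding assms(2) using assms(1) by (simp add: real_sqrt_divide)
  show "tempered_half_differentiable \<eta> (\<lambda>s. v x y s) t"
    unfolding tempered_half_differentiable_def assms(2,3)
    by (rule half_deriv_exp_drift_density[OF xyt])
  show "(\<lambda>w. v x w t) field_differentiable at y"
    unfolding field_differentiable_def assms(3) using has_derivative_drift_density[OF xyt(2)] by blast
  show "tempered_half_deriv \<eta> (\<lambda>s. v x y s) t =
      - deriv (\<lambda>w. v x w t) y + v x y t * sqrt \<eta> * tanh (sqrt \<eta> * (y - x)) - \<mu> / 2 * v x y t"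
    unfolding \<eta> unfolding assms(2,3) by (rule tempered_equation_drift_density[OF assms(1) xyt])
next
  fix x :: real
  show "weakly_tends_to (\<lambda>t. density lborel (\<lambda>y. ennreal (if x < y then v x y t else 0)))
      (return borel x) (at_right 0)"
    unfolding assms(3) by (rule weakly_tends_to_drift_density)
next
  fix x t :: real
  assume "0 < t"
  then show "((\<lambda>y. v x y t) \<longlongrightarrow> exp (- (\<eta> * t)) / sqrt (pi * t)) (at_right x)"
    unfolding assms(2,3) by (rule tendsto_drift_density_boundary)
qed

end
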